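(* Let $n\geq 2$. There exist constants $0 < c< 1$ and $K>0$ such that the following holds. Let $X \subset \mathbb{R}^n$ be a nonempty finite set such that $|X\setminus \ell| \geq c|X|$ for all affine lines $\ell\subset\mathbb{R}^n$. Then, for all finite $Y\subset \mathbb{R}^n$, $$\max_{x\in X} |\pi_x(Y\setminus \{x\})| \geq K \min\{|X|, |Y|\}.$$
   Context: $|\cdot|$ of a finite set denotes cardinality. For $x\in\mathbb{R}^n$, $\pi_x:\mathbb{R}^n\setminus\{x\}\to\mathbb{S}^{n-1}$ is the radial projection $\pi_x(y)=\frac{y-x}{|y-x|}$. *)

theory Defs
  imports "HOL-Analysis.Analysis"
begin

text \<open>The value at \<open>y = x\<close> is the junk value \<open>0\<close>; away from it the values lie on the unit sphere.\<close>

definition radial_proj :: "real ^ 'n \<Rightarrow> real ^ 'n \<Rightarrow> real ^ 'n"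
  where "radial_proj x y = (y - x) /\<^sub>R norm (y - x)"

definition affine_line :: "(real ^ 'n) set \<Rightarrow> bool"
  where "affine_line L \<longleftrightarrow> affine L \<and> aff_dim L = 1"

end

theory Submission
  imports Defs
begin

text \<open>
  A generic linear map to the plane is injective on \<open>X \<union> Y\<close>, keeps non-collinear triples of \<open>X\<close>
  non-collinear, and does not increase the number of directions seen from a point, so the problem
  is planar; one may also shrink \<open>Y\<close> to at most \<open>card X\<close> points. If every \<open>x \<in> X\<close> saw only few
  directions, most of \<open>Y\<close> would lie on lines through \<open>x\<close> that contain at least \<open>k\<close> points of \<open>Y\<close>,
  so the sum of \<open>card (X \<inter> l) * card (Y \<inter> l)\<close> over the \<open>k\<close>-rich lines \<open>l\<close> would be at least
  \<open>card X * card Y / 4\<close>. The boundedly many lines that carry a positive proportion \<open>\<epsilon>\<close> of \<open>Y\<close>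
  contribute little because each of them contains few points of \<open>X\<close>. The remaining ones contribute
  little by the Cauchy-Schwarz inequality and Beck's estimate: the Szemeredi-Trotter bound
  \<open>O(n\<^sup>2 / j\<^sup>3 + n / j)\<close> for the number of \<open>j\<close>-rich lines makes the sum of \<open>card (Y \<inter> l)\<^sup>2\<close> over
  these lines a small multiple of \<open>card Y ^ 2\<close>. The Szemeredi-Trotter bound follows from a crossing
  inequality for the graph that joins consecutive points on the lines. Its input, that a
  straight-line plane graph has linearly many edges, is proved by a sweep instead of Euler's formula.
\<close>

section \<open>Straight-line plane graphs\<close>

type_synonym point = "real \<times> real"
type_synonym edge = "point \<times> point"

definition slope :: "edge \<Rightarrow> real"
  where "slope e = (snd (snd e) - snd (fst e)) / (fst (snd e) - fst (fst e))"

definition height :: "edge \<Rightarrow> real \<Rightarrow> real"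
  where "height e t = snd (fst e) + slope e * (t - fst (fst e))"

text \<open>A common point is tolerated only when it is an end of both edges; an end of one inside
  the other, or an overlap along a segment, counts as a crossing.\<close>

definition crossing_at :: "edge \<Rightarrow> edge \<Rightarrow> real \<Rightarrow> bool"
  where "crossing_at e f t \<longleftrightarrow>
    fst (fst e) \<le> t \<and> t \<le> fst (snd e) \<and> fst (fst f) \<le> t \<and> t \<le> fst (snd f) \<and>
    height e t = height f t \<and>
    \<not> ((t = fst (fst e) \<or> t = fst (snd e)) \<and> (t = fst (fst f) \<or> t = fst (snd f)))"

lemma height_start [simp]: "height e (fst (fst e)) = snd (fst e)"
  by (simp add: height_def)

lemma height_end: "fst (fst e) < fst (snd e) \<Longrightarrow> height e (fst (snd e)) = snd (snd e)"
  by (simp add: height_def slope_def)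

lemma height_cross:
  assumes "s < t" "height e s < height f s" "height f t \<le> height e t"
  obtains r where "s < r" "r \<le> t" "height e r = height f r"
proof -
  have "continuous_on {s..t} (\<lambda>r. height e r - height f r)"
    unfolding height_def by (intro continuous_intros)
  then obtain r where "s \<le> r" "r \<le> t" "height e r - height f r = 0"
    using IVT'[of "\<lambda>r. height e r - height f r" s 0 t] assms by fastforce
  with assms show thesis by (intro that[of r]) (auto simp: less_le)
qed

text \<open>Edges point from left to right. Injective abscissas let the abscissa identify a vertex,
  so a left-to-right sweep meets no ties.\<close>

locale plane_graph =
  fixes V :: "point set" and E :: "edge set"
  assumes finite_V: "finite V"
    and inj_V: "inj_on fst V"
    and E_sub: "E \<subseteq> V \<times> V"
    and E_less: "e \<in> E \<Longrightarrow> fst (fst e) < fst (snd e)"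
    and no_interior: "e \<in> E \<Longrightarrow> v \<in> V \<Longrightarrow> fst (fst e) < fst v \<Longrightarrow> fst v < fst (snd e) \<Longrightarrow>
      snd v \<noteq> height e (fst v)"
    and no_crossing: "e \<in> E \<Longrightarrow> f \<in> E \<Longrightarrow> e \<noteq> f \<Longrightarrow> \<not> crossing_at e f t"
begin

lemma finite_E: "finite E"
  using E_sub finite_V by (meson finite_SigmaI finite_subset)

lemma ends_in_V: "e \<in> E \<Longrightarrow> fst e \<in> V" "e \<in> E \<Longrightarrow> snd e \<in> V"
  using E_sub by auto

lemma on_edge:
  assumes "e \<in> E" "v \<in> V" "fst (fst e) < fst v" "fst v \<le> fst (snd e)" "snd v = height e (fst v)"
  shows "v = snd e"
  using assms no_interior[of e v] inj_V ends_in_V[of e]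
  by (metis inj_on_def order_le_less)

text \<open>Continuity gives a common point over some \<open>r > s\<close>. As the edges do not
  cross, \<open>r\<close> is an end of both, and only right ends lie beyond \<open>s\<close>; hence
  \<open>r = t\<close>.\<close>

lemma meet_at_end:
  assumes "e \<in> E" "f \<in> E" "fst (fst e) \<le> s" "fst (fst f) \<le> s" "s < t"
    "t \<le> fst (snd e)" "t \<le> fst (snd f)"
    "height e s < height f s" "height f t \<le> height e t"
  shows "t = fst (snd e)" "t = fst (snd f)"
proof -
  obtain r where r: "s < r" "r \<le> t" "height e r = height f r"
    using height_cross assms by metis
  have "e \<noteq> f" using assms by auto
  then have "\<not> crossing_at e f r" using no_crossing assms by blast
  with r assms have "r = fst (snd e)" "r = fst (snd f)"
    unfolding crossing_at_def by auto
  with r assms show "t = fst (snd e)" "t = fst (snd f)" by auto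
qed

text \<open>Two different such edges would overlap right of the common end, which counts as a
  crossing.\<close>

lemma slope_inj:
  assumes "e \<in> E" "f \<in> E" "fst e = fst f" "slope e = slope f"
  shows "e = f"
proof (rule ccontr)
  assume "e \<noteq> f"
  define t where "t = (fst (fst e) + min (fst (snd e)) (fst (snd f))) / 2"
  have "fst (fst e) < t" "t < fst (snd e)" "t < fst (snd f)"
    unfolding t_def using E_less[of e] E_less[of f] assms by (auto simp: min_def)
  then have "crossing_at e f t"
    using assms unfolding crossing_at_def height_def by auto
  with no_crossing \<open>e \<noteq> f\<close> assms show False by blast
qed

definition non_top :: "edge set"
  where "non_top = {e \<in> E. \<exists>f \<in> E. fst f = fst e \<and> slope e < slope f}"

lemma card_top: "card (E - non_top) \<le> card V"
proof (rule card_inj_on_le[of fst])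
  show "inj_on fst (E - non_top)"
  proof (rule inj_onI)
    fix e f assume *: "e \<in> E - non_top" "f \<in> E - non_top" "fst e = fst f"
    then have "slope e = slope f"
      unfolding non_top_def by (auto simp: not_less intro!: antisym)
    with * show "e = f" using slope_inj by blast
  qed
qed (use ends_in_V finite_V in auto)

definition next_edge :: "edge \<Rightarrow> edge"
  where "next_edge e = arg_min_on slope {f \<in> E. fst f = fst e \<and> slope e < slope f}"

lemma next_edge:
  assumes "e \<in> non_top"
  shows "next_edge e \<in> E" "fst (next_edge e) = fst e" "slope e < slope (next_edge e)"
    and "\<And>g. g \<in> E \<Longrightarrow> fst g = fst e \<Longrightarrow> slope e < slope g \<Longrightarrow> slope (next_edge e) \<le> slope g"
proof -
  let ?S = "{f \<in> E. fst f = fst e \<and> slope e < slope f}"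
  have S: "finite ?S" "?S \<noteq> {}"
    using assms finite_E unfolding non_top_def by (simp, blast)
  from arg_min_if_finite(1)[OF S, of slope] show "next_edge e \<in> E" "fst (next_edge e) = fst e"
    "slope e < slope (next_edge e)" unfolding next_edge_def by auto
  show "slope (next_edge e) \<le> slope g" if "g \<in> E" "fst g = fst e" "slope e < slope g" for g
    unfolding next_edge_def by (rule arg_min_least[OF S]) (use that in auto)
qed

text \<open>
  Edges are counted by charging a non-top edge \<open>e\<close> to the leftmost vertex \<open>apex e\<close> in the wedge
  between \<open>e\<close> and the next edge above it with the same left end. No edge can separate the apex
  from its wedge, which makes the charge injective up to the case \<open>apex e = snd e\<close>.
\<close>

definition wedge :: "edge \<Rightarrow> point set"
  where "wedge e = {v \<in> V. fst (fst e) < fst v \<and> fst v \<le> fst (snd e) \<and>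
    fst v \<le> fst (snd (next_edge e)) \<and>
    height e (fst v) \<le> snd v \<and> snd v \<le> height (next_edge e) (fst v)}"

definition apex :: "edge \<Rightarrow> point"
  where "apex e = arg_min_on fst (wedge e)"

text \<open>Of the right ends of the two bounding edges, the one further left lies in the
  wedge.\<close>

lemma wedge_nonempty:
  assumes "e \<in> non_top"
  shows "wedge e \<noteq> {}"
proof -
  note n = next_edge[OF assms]
  have e: "e \<in> E" using assms by (simp add: non_top_def)
  have le: "height e t \<le> height (next_edge e) t" if "fst (fst e) < t" for t
    using n that by (simp add: height_def mult_right_mono)
  show ?thesis
  proof (cases "fst (snd e) \<le> fst (snd (next_edge e))")
    case True
    then have "snd e \<in> wedge e"
      unfolding wedge_def using ends_in_V[OF e] E_less[OF e] height_end le[of "fst (snd e)"] by auto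
    then show ?thesis by auto
  next
    case False
    then have "snd (next_edge e) \<in> wedge e"
      unfolding wedge_def
      using ends_in_V[OF n(1)] E_less[OF n(1)] height_end[of "next_edge e"] n(2)
        le[of "fst (snd (next_edge e))"] by auto
    then show ?thesis by auto
  qed
qed

lemma apex:
  assumes "e \<in> non_top"
  shows "apex e \<in> wedge e" "\<And>v. v \<in> wedge e \<Longrightarrow> fst (apex e) \<le> fst v"
proof -
  have S: "finite (wedge e)" "wedge e \<noteq> {}"
    using wedge_nonempty[OF assms] finite_V unfolding wedge_def by auto
  show "apex e \<in> wedge e" unfolding apex_def by (rule arg_min_if_finite[OF S])
  show "fst (apex e) \<le> fst v" if "v \<in> wedge e" for v
    unfolding apex_def by (rule arg_min_least[OF S that])
qed

text \<open>With a common left end, \<open>next_edge e1\<close> is not above \<open>e2\<close>, so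
  the wedges share only points of \<open>e2\<close>. Otherwise \<open>e2\<close> starts outside the
  wedge of \<open>e1\<close>, and reaching the common apex forces bounding edges of the two wedges
  to end there together. The flag \<open>apex e = snd e\<close> then gives \<open>e\<close> and
  \<open>next_edge e\<close> the same ends for one of the two.\<close>

lemma apex_distinct:
  assumes e1: "e1 \<in> non_top" and e2: "e2 \<in> non_top"
    and eq: "apex e1 = apex e2" "apex e1 = snd e1 \<longleftrightarrow> apex e2 = snd e2"
    and le: "fst (fst e1) < fst (fst e2) \<or> fst e1 = fst e2 \<and> slope e1 < slope e2"
  shows False
proof -
  define w where "w = apex e1"
  have E: "e1 \<in> E" "e2 \<in> E" using e1 e2 by (auto simp: non_top_def)
  note n1 = next_edge[OF e1] and n2 = next_edge[OF e2]
  have w1: "w \<in> wedge e1" and w2: "w \<in> wedge e2" 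
    using apex(1)[OF e1] apex(1)[OF e2] eq w_def by auto
  have wV: "w \<in> V" using w1 by (simp add: wedge_def)
  have endw: "w = snd e" if "e \<in> E" "fst w = fst (snd e)" for e
    using that wV ends_in_V(2)[of e] inj_V by (metis inj_onD)
  have same: "w = snd e1 \<longleftrightarrow> w = snd e2" using eq w_def by simp
  show False using le
  proof
    assume *: "fst e1 = fst e2 \<and> slope e1 < slope e2"
    then have "slope (next_edge e1) \<le> slope e2" using n1(4) E by auto
    then have "height (next_edge e1) (fst w) \<le> height e2 (fst w)"
      using * n1(2) w1 by (auto simp: height_def wedge_def intro: mult_right_mono)
    then have "snd w = height e2 (fst w)" using w1 w2 by (auto simp: wedge_def)
    then have "w = snd e2" using on_edge[OF E(2) wV] w2 by (auto simp: wedge_def)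
    with same * have "e1 = e2" by (simp add: prod_eq_iff)
    with * show False by simp
  next
    assume less: "fst (fst e1) < fst (fst e2)"
    let ?u = "fst e2"
    have u: "?u \<in> V" "fst ?u < fst w" using ends_in_V E w2 by (auto simp: wedge_def)
    \<comment> \<open>The apex is leftmost in its wedge, so \<open>?u\<close> is too far left to
      belong to it; the abscissa bounds hold, hence a height bound fails.\<close>
    then have "?u \<notin> wedge e1" using apex(2)[OF e1, of ?u] w_def by auto
    then consider "snd ?u < height e1 (fst ?u)" | "snd ?u > height (next_edge e1) (fst ?u)"
      using less u w1 unfolding wedge_def by auto
    then show False
    proof cases
      case 1
      have "height (next_edge e2) (fst ?u) = snd ?u" using height_start n2(2) by metis
      \<comment> \<open>\<open>next_edge e2\<close> starts below \<open>e1\<close> and is at or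
        above it over \<open>w\<close>.\<close>
      then have "fst w = fst (snd (next_edge e2))" "fst w = fst (snd e1)"
        using meet_at_end[OF n2(1) E(1), of "fst ?u" "fst w"] 1 less u w1 w2 n2(2)
        by (auto simp: wedge_def)
      then have "w = snd (next_edge e2)" "w = snd e2" using endw[OF n2(1)] endw[OF E(1)] same by blast+
      with n2 show False by (metis less_irrefl prod_eqI)
    next
      case 2
      \<comment> \<open>\<open>next_edge e1\<close> is below \<open>e2\<close> over
        \<open>?u\<close> and at or above it over \<open>w\<close>.\<close>
      have "fst w = fst (snd (next_edge e1))" "fst w = fst (snd e2)"
        using meet_at_end[OF n1(1) E(2), of "fst ?u" "fst w"] 2 less u w1 w2 n1(2)
        by (auto simp: wedge_def)
      then have "w = snd (next_edge e1)" "w = snd e1" using endw[OF n1(1)] endw[OF E(2)] same by blast+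
      with n1 show False by (metis less_irrefl prod_eqI)
    qed
  qed
qed

text \<open>The factor 2 counts the values of the flag \<open>apex e = snd e\<close>.\<close>

lemma card_non_top: "card non_top \<le> 2 * card V"
proof -
  have "inj_on (\<lambda>e. (apex e, apex e = snd e)) non_top"
  proof (rule inj_onI)
    fix e f assume *: "e \<in> non_top" "f \<in> non_top"
      "(apex e, apex e = snd e) = (apex f, apex f = snd f)"
    then have E: "e \<in> E" "f \<in> E" by (auto simp: non_top_def)
    have "fst (fst e) = fst (fst f)"
      using apex_distinct[of e f] apex_distinct[of f e] * by force
    then have "fst e = fst f" using E ends_in_V(1) inj_V by (metis inj_onD)
    moreover from this have "slope e = slope f"
      using apex_distinct[of e f] apex_distinct[of f e] * by force
    ultimately show "e = f" using slope_inj E by blast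
  qed
  moreover have "(\<lambda>e. (apex e, apex e = snd e)) ` non_top \<subseteq> V \<times> UNIV"
    using apex(1) by (force simp: wedge_def)
  ultimately have "card non_top \<le> card (V \<times> (UNIV :: bool set))"
    by (intro card_inj_on_le) (auto simp: finite_V)
  then show ?thesis by (simp add: card_cartesian_product)
qed

lemma card_edges_le: "card E \<le> 3 * card V"
proof -
  have "card E = card non_top + card (E - non_top)"
    using card_Int_Diff[OF finite_E, of non_top] by (simp add: non_top_def Int_def)
  then show ?thesis using card_top card_non_top by linarith
qed

end

section \<open>The crossing inequality\<close>

text \<open>For \<open>0 \<le> p \<le> 1\<close> this is the probability that a random subset
  contains \<open>A\<close>. It is the expansion of the product of \<open>p + ?g i\<close> over
  \<open>V\<close>; since \<open>?g\<close> vanishes on \<open>A\<close>, only supersets of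
  \<open>A\<close> survive.\<close>

lemma sum_subset_weights:
  fixes p :: real
  assumes "finite V" "A \<subseteq> V"
  shows "(\<Sum>S\<in>Pow V. p ^ card S * (1 - p) ^ card (V - S) * of_bool (A \<subseteq> S)) = p ^ card A"
proof -
  let ?g = "\<lambda>i. if i \<in> A then 0 else 1 - p"
  have "(\<Sum>S\<in>Pow V. p ^ card S * (1 - p) ^ card (V - S) * of_bool (A \<subseteq> S)) =
    (\<Sum>S\<in>Pow V. (\<Prod>i\<in>S. p) * (\<Prod>i\<in>V - S. ?g i))"
  proof (rule sum.cong)
    fix S assume S: "S \<in> Pow V"
    show "p ^ card S * (1 - p) ^ card (V - S) * of_bool (A \<subseteq> S) = (\<Prod>i\<in>S. p) * (\<Prod>i\<in>V - S. ?g i)"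
    proof (cases "A \<subseteq> S")
      case True
      then have "(\<Prod>i\<in>V - S. ?g i) = (\<Prod>i\<in>V - S. 1 - p)" by (intro prod.cong) auto
      with True show ?thesis by simp
    next
      case False
      then have "\<exists>i\<in>V - S. ?g i = 0" using assms by auto
      then have "(\<Prod>i\<in>V - S. ?g i) = 0" using assms by (intro prod_zero) auto
      with False show ?thesis by simp
    qed
  qed simp
  also have "\<dots> = (\<Prod>i\<in>V. p + ?g i)"
    by (rule prod_add[symmetric]) (rule assms)
  also have "\<dots> = (\<Prod>i\<in>V. if i \<in> A then p else 1)" by (intro prod.cong) auto
  also have "\<dots> = p ^ card A"
    using assms by (simp add: prod.If_cases Int_absorb1)
  finally show ?thesis .
qed

text \<open>Linearity of expectation, applied to the indices \<open>i\<close> whose set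
  \<open>A i\<close> survives the sampling.\<close>

lemma sum_subset_weights_card:
  fixes p :: real
  assumes "finite V" "finite I" "\<And>i. i \<in> I \<Longrightarrow> A i \<subseteq> V" "\<And>i. i \<in> I \<Longrightarrow> card (A i) = k"
  shows "(\<Sum>S\<in>Pow V. p ^ card S * (1 - p) ^ card (V - S) * real (card {i \<in> I. A i \<subseteq> S})) =
    real (card I) * p ^ k"
proof -
  have "(\<Sum>S\<in>Pow V. p ^ card S * (1 - p) ^ card (V - S) * real (card {i \<in> I. A i \<subseteq> S})) =
    (\<Sum>S\<in>Pow V. \<Sum>i\<in>I. p ^ card S * (1 - p) ^ card (V - S) * of_bool (A i \<subseteq> S))"
    using assms(2) by (simp add: sum_distrib_left[symmetric] Int_def)
  also have "\<dots> = (\<Sum>i\<in>I. \<Sum>S\<in>Pow V. p ^ card S * (1 - p) ^ card (V - S) * of_bool (A i \<subseteq> S))"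
    by (rule sum.swap)
  also have "\<dots> = (\<Sum>i\<in>I. p ^ k)"
    by (intro sum.cong refl) (simp only: sum_subset_weights[OF assms(1) assms(3)] assms(4))
  finally show ?thesis by simp
qed

text \<open>Averaging over a random subset of \<open>V\<close> that contains each vertex with probability \<open>p\<close>.\<close>

lemma crossing_sampling:
  fixes p :: real and V :: "'a set" and E :: "('a \<times> 'a) set" and B :: "(('a \<times> 'a) \<times> ('a \<times> 'a)) set"
  assumes fin: "finite V" and E: "E \<subseteq> V \<times> V" and B: "B \<subseteq> E \<times> E"
    and E2: "\<And>e. e \<in> E \<Longrightarrow> fst e \<noteq> snd e"
    and B4: "\<And>e f. (e, f) \<in> B \<Longrightarrow> {fst e, snd e} \<inter> {fst f, snd f} = {}"
    and bound: "\<And>S. S \<subseteq> V \<Longrightarrow> card {e \<in> E. {fst e, snd e} \<subseteq> S} \<le>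
      c * card S + card {b \<in> B. {fst (fst b), snd (fst b), fst (snd b), snd (snd b)} \<subseteq> S}"
    and p: "0 \<le> p" "p \<le> 1"
  shows "card E * p ^ 2 \<le> c * (card V * p) + card B * p ^ 4"
proof -
  have finE: "finite E" and finB: "finite B"
    using fin E B by (meson finite_SigmaI finite_subset)+
  let ?w = "\<lambda>S. p ^ card S * (1 - p) ^ card (V - S)"
  let ?A = "\<lambda>b. {fst (fst b), snd (fst b), fst (snd b), snd (snd b)}"
  \<comment> \<open>A crossing survives with probability \<open>p ^ 4\<close> because its four ends
    are distinct.\<close>
  have card4: "card (?A b) = 4" if "b \<in> B" for b
    using that B4[of "fst b" "snd b"] E2[of "fst b"] E2[of "snd b"] B by auto
  have vert: "real (card S) = real (card {i \<in> V. {i} \<subseteq> S})" if "S \<in> Pow V" for S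
    using that by (intro arg_cong[of _ _ real] arg_cong[of _ _ card]) auto
  have "card E * p ^ 2 = (\<Sum>S\<in>Pow V. ?w S * real (card {e \<in> E. {fst e, snd e} \<subseteq> S}))"
    by (rule sum_subset_weights_card[symmetric]) (use fin finE E E2 in \<open>auto simp: card_2_iff\<close>)
  also have "\<dots> \<le> (\<Sum>S\<in>Pow V. ?w S * real (c * card S + card {b \<in> B. ?A b \<subseteq> S}))"
    using bound p by (intro sum_mono mult_left_mono of_nat_mono) auto
  also have "\<dots> = c * (\<Sum>S\<in>Pow V. ?w S * real (card S)) + (\<Sum>S\<in>Pow V. ?w S * real (card {b \<in> B. ?A b \<subseteq> S}))"
    by (simp add: sum_distrib_left sum.distrib[symmetric] algebra_simps)
  also have "(\<Sum>S\<in>Pow V. ?w S * real (card S)) = (\<Sum>S\<in>Pow V. ?w S * real (card {i \<in> V. {i} \<subseteq> S}))"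
    by (intro sum.cong refl) (simp only: vert)
  also have "\<dots> = card V * p ^ 1"
    by (rule sum_subset_weights_card) (use fin in auto)
  also have "(\<Sum>S\<in>Pow V. ?w S * real (card {b \<in> B. ?A b \<subseteq> S})) = card B * p ^ 4"
    by (rule sum_subset_weights_card) (use fin finB card4 B E in auto)
  finally show ?thesis by simp
qed

section \<open>Lines and the graph of consecutive points on them\<close>

text \<open>A line is the pair of its slope and intercept. Vertical lines are left out: with
  injective abscissas each would hold at most one point.\<close>

definition on_line :: "point set \<Rightarrow> real \<times> real \<Rightarrow> point set"
  where "on_line V l = {v \<in> V. snd v = fst l * fst v + snd l}"

definition consecutive :: "point set \<Rightarrow> real \<times> real \<Rightarrow> edge set"
  where "consecutive V l = {e \<in> on_line V l \<times> on_line V l. fst (fst e) < fst (snd e) \<and>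
    (\<forall>w \<in> on_line V l. \<not> (fst (fst e) < fst w \<and> fst w < fst (snd e)))}"

text \<open>\<open>height e 0\<close> is the intercept, so this recovers the pair that encodes the
  line through an edge.\<close>

definition line_of :: "edge \<Rightarrow> real \<times> real"
  where "line_of e = (slope e, height e 0)"

lemma on_line_subset: "on_line V l \<subseteq> V"
  by (auto simp: on_line_def)

lemma consecutiveD:
  assumes "e \<in> consecutive V l"
  shows "fst e \<in> on_line V l" "snd e \<in> on_line V l" "fst (fst e) < fst (snd e)"
    "\<And>w. w \<in> on_line V l \<Longrightarrow> fst w \<le> fst (fst e) \<or> fst (snd e) \<le> fst w"
  using assms unfolding consecutive_def by (auto simp: not_less)

lemma consecutive_slope:
  assumes "e \<in> consecutive V l"
  shows "slope e = fst l"
proof -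
  note e = consecutiveD[OF assms]
  have "snd (snd e) - snd (fst e) = fst l * (fst (snd e) - fst (fst e))"
    using e(1,2) unfolding on_line_def by (simp add: algebra_simps)
  then show ?thesis using e(3) by (simp add: slope_def)
qed

lemma consecutive_height:
  assumes "e \<in> consecutive V l"
  shows "height e t = fst l * t + snd l"
  using consecutiveD(1)[OF assms] consecutive_slope[OF assms]
  by (simp add: height_def on_line_def algebra_simps)

lemma consecutive_line_of: "e \<in> consecutive V l \<Longrightarrow> line_of e = l"
  by (simp add: line_of_def consecutive_slope consecutive_height)

text \<open>Every point except the rightmost starts an edge, to its nearest successor. For an empty
  line the truncated subtraction gives 0.\<close>

lemma card_consecutive:
  assumes "finite V" "inj_on fst V"
  shows "card (on_line V l) - 1 \<le> card (consecutive V l)"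
proof (cases "on_line V l = {}")
  case False
  let ?P = "on_line V l"
  have fin: "finite ?P" and inj: "inj_on fst ?P"
    using assms on_line_subset by (blast intro: finite_subset inj_on_subset)+
  have fc: "finite (consecutive V l)" unfolding consecutive_def using fin by auto
  have "Max (fst ` ?P) \<in> fst ` ?P" using fin False by (intro Max_in) auto
  then obtain m where m: "m \<in> ?P" "fst m = Max (fst ` ?P)" by auto
  then have le_m: "fst v \<le> fst m" if "v \<in> ?P" for v using that fin by simp
  have "?P - {m} \<subseteq> fst ` consecutive V l"
  proof
    fix u assume u: "u \<in> ?P - {m}"
    then have "fst u < fst m" using m(1) le_m inj by (metis Diff_iff inj_onD insertI1 order_le_less)
    let ?Q = "{v \<in> ?P. fst u < fst v}"
    have Q: "finite ?Q" using fin by simp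
    have Q_ne: "?Q \<noteq> {}" using m(1) \<open>fst u < fst m\<close> by blast
    define v where "v = arg_min_on fst ?Q"
    have "v \<in> ?Q" unfolding v_def by (rule arg_min_if_finite[OF Q Q_ne])
    moreover have "fst v \<le> fst w" if "w \<in> ?Q" for w
      unfolding v_def by (rule arg_min_least[OF Q Q_ne that])
    ultimately have "(u, v) \<in> consecutive V l"
      using u unfolding consecutive_def by force
    then show "u \<in> fst ` consecutive V l" by force
  qed
  then have "card (?P - {m}) \<le> card (fst ` consecutive V l)"
    using fc by (intro card_mono) auto
  also have "\<dots> \<le> card (consecutive V l)" by (rule card_image_le[OF fc])
  finally show ?thesis using m(1) by (simp add: card_Diff_singleton)
qed simp

lemma crossing_at_commute: "crossing_at e f t \<longleftrightarrow> crossing_at f e t"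
  unfolding crossing_at_def by auto

lemma lines_meet_once:
  fixes l l' :: "real \<times> real"
  assumes "fst l * s + snd l = fst l' * s + snd l'" "fst l * t + snd l = fst l' * t + snd l'" "s \<noteq> t"
  shows "l = l'"
proof -
  have "(fst l - fst l') * (s - t) = 0" using assms by (simp add: algebra_simps)
  then show ?thesis using assms by (simp add: prod_eq_iff)
qed

locale line_arrangement =
  fixes V :: "point set" and L :: "(real \<times> real) set"
  assumes finite_V: "finite V"
    and inj_V: "inj_on fst V"
    and finite_L: "finite L"
begin

definition edges :: "edge set"
  where "edges = (\<Union>l\<in>L. consecutive V l)"

definition crossings :: "(edge \<times> edge) set"
  where "crossings = {b \<in> edges \<times> edges. fst b \<noteq> snd b \<and> (\<exists>t. crossing_at (fst b) (snd b) t)}"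

lemma finite_consecutive: "finite (consecutive V l)"
  using finite_V on_line_subset[of V l] unfolding consecutive_def
  by (simp add: finite_subset)

lemma edgesD:
  assumes "e \<in> edges"
  shows "e \<in> consecutive V (line_of e)" "line_of e \<in> L"
proof -
  obtain l where "l \<in> L" "e \<in> consecutive V l" using assms unfolding edges_def by blast
  with consecutive_line_of[of e V l] show "e \<in> consecutive V (line_of e)" "line_of e \<in> L" by simp_all
qed

lemma edges_subset: "edges \<subseteq> V \<times> V"
  using on_line_subset unfolding edges_def consecutive_def by auto

lemma finite_edges: "finite edges"
  unfolding edges_def using finite_L finite_consecutive by auto

lemma card_edges_ge: "(\<Sum>l\<in>L. card (on_line V l) - 1) \<le> card edges"
proof -
  have "card edges = (\<Sum>l\<in>L. card (consecutive V l))"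
    unfolding edges_def using finite_L finite_consecutive consecutive_line_of
    by (intro card_UN_disjoint) (blast+)
  then show ?thesis
    using card_consecutive[OF finite_V inj_V] by (simp add: sum_mono)
qed

text \<open>No point of the line lies strictly inside either edge, so edges over a common
  \<open>t\<close>, interior to one of them, have the same ends.\<close>

lemma consecutive_unique:
  assumes "e \<in> consecutive V l" "f \<in> consecutive V l"
    "fst (fst e) < t" "t < fst (snd e)" "fst (fst f) \<le> t" "t \<le> fst (snd f)"
  shows "e = f"
proof -
  note e = consecutiveD[OF assms(1)] and f = consecutiveD[OF assms(2)]
  have "fst (fst e) = fst (fst f)" "fst (snd e) = fst (snd f)"
    using e(4)[OF f(1)] e(4)[OF f(2)] f(4)[OF e(1)] f(4)[OF e(2)] e(3) f(3) assms by linarith+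
  moreover have "fst e \<in> V" "snd e \<in> V" "fst f \<in> V" "snd f \<in> V"
    using e f on_line_subset by blast+
  ultimately show ?thesis using inj_V by (metis inj_onD prod_eqI)
qed

text \<open>Edges of one line would coincide by \<open>consecutive_unique\<close>. An end of
  \<open>f\<close> over \<open>t\<close> would be a point of \<open>V\<close> strictly inside
  \<open>e\<close>, against consecutiveness.\<close>

lemma crossing_half:
  assumes "e \<in> edges" "f \<in> edges" "e \<noteq> f" "crossing_at e f t" "fst (fst e) < t" "t < fst (snd e)"
  shows "line_of e \<noteq> line_of f" "fst (fst f) < t" "t < fst (snd f)"
proof -
  note c = assms(4)[unfolded crossing_at_def]
  note e = edgesD(1)[OF assms(1)] and f = edgesD(1)[OF assms(2)]
  show "line_of e \<noteq> line_of f"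
    using consecutive_unique[OF e, of f t] f assms c by auto
  have "fst v \<noteq> t" if "v \<in> on_line V (line_of f)" for v
  proof
    assume t: "fst v = t"
    then have "snd v = height f t"
      using that consecutive_height[OF f, of t] by (simp add: on_line_def)
    then have "v \<in> on_line V (line_of e)"
      using that c t consecutive_height[OF e, of t] by (simp add: on_line_def)
    then show False using consecutiveD(4)[OF e, of v] t assms by auto
  qed
  then have "fst (fst f) \<noteq> t" "fst (snd f) \<noteq> t" using consecutiveD(1,2)[OF f] by auto
  then show "fst (fst f) < t" "t < fst (snd f)" using c by auto
qed

lemma crossing_interior:
  assumes "e \<in> edges" "f \<in> edges" "e \<noteq> f" "crossing_at e f t"
  shows "line_of e \<noteq> line_of f" "fst (fst e) < t" "t < fst (snd e)" "fst (fst f) < t" "t < fst (snd f)"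
proof -
  consider "fst (fst e) < t" "t < fst (snd e)" | "fst (fst f) < t" "t < fst (snd f)"
    using assms(4) unfolding crossing_at_def by linarith
  then have "line_of e \<noteq> line_of f \<and> fst (fst e) < t \<and> t < fst (snd e) \<and> fst (fst f) < t \<and> t < fst (snd f)"
  proof cases
    case 1
    then show ?thesis using crossing_half[OF assms] by simp
  next
    case 2
    have "crossing_at f e t" using assms(4) crossing_at_commute by blast
    then show ?thesis using crossing_half[OF assms(2,1) assms(3)[symmetric] _ 2] 2 by force
  qed
  then show "line_of e \<noteq> line_of f" "fst (fst e) < t" "t < fst (snd e)" "fst (fst f) < t" "t < fst (snd f)"
    by simp_all
qed

text \<open>A shared end besides the crossing point would give two distinct lines two common
  points.\<close>

lemma crossings_disjoint:
  assumes "(e, f) \<in> crossings"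
  shows "{fst e, snd e} \<inter> {fst f, snd f} = {}"
proof (rule ccontr)
  assume "\<not> ?thesis"
  then obtain v where v: "v \<in> {fst e, snd e}" "v \<in> {fst f, snd f}" by blast
  from assms obtain t where *: "e \<in> edges" "f \<in> edges" "e \<noteq> f" "crossing_at e f t"
    unfolding crossings_def by auto
  note i = crossing_interior[OF *]
  note e = edgesD(1)[OF *(1)] and f = edgesD(1)[OF *(2)]
  have "fst v \<noteq> t" using v(1) i by auto
  moreover have "v \<in> on_line V (line_of e)" "v \<in> on_line V (line_of f)"
    using v consecutiveD(1,2)[OF e] consecutiveD(1,2)[OF f] by auto
  moreover have "height e t = height f t" using *(4) by (simp add: crossing_at_def)
  ultimately have "line_of e = line_of f"
    using lines_meet_once[of "line_of e" "fst v" "line_of f" t]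
    by (simp add: on_line_def consecutive_height[OF e] consecutive_height[OF f])
  with i show False by simp
qed

text \<open>Two lines fix the abscissa of their common point, and that abscissa fixes the edge on
  either line.\<close>

lemma card_crossings: "card crossings \<le> card L ^ 2"
proof -
  have "inj_on (map_prod line_of line_of) crossings"
  proof (rule inj_onI)
    fix b b' assume b: "b \<in> crossings" "b' \<in> crossings" and
      eq: "map_prod line_of line_of b = map_prod line_of line_of b'"
    obtain e f e' f' where bb: "b = (e, f)" "b' = (e', f')" by (metis surj_pair)
    with eq have l: "line_of e = line_of e'" "line_of f = line_of f'" by auto
    from b bb obtain t t' where t: "e \<in> edges" "f \<in> edges" "e \<noteq> f" "crossing_at e f t"
      and t': "e' \<in> edges" "f' \<in> edges" "e' \<noteq> f'" "crossing_at e' f' t'"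
      unfolding crossings_def by auto
    note i = crossing_interior[OF t] and i' = crossing_interior[OF t']
    note e = edgesD(1)[OF t(1)] and f = edgesD(1)[OF t(2)]
    note e' = edgesD(1)[OF t'(1)] and f' = edgesD(1)[OF t'(2)]
    have "height e t = height f t" "height e' t' = height f' t'"
      using t(4) t'(4) by (auto simp: crossing_at_def)
    then have "t = t'"
      using lines_meet_once[of "line_of e" t "line_of f" t'] i(1) l
      by (simp add: consecutive_height[OF e] consecutive_height[OF f]
        consecutive_height[OF e'] consecutive_height[OF f']) blast
    then have "e = e'" "f = f'"
      using consecutive_unique[OF e, of e' t] consecutive_unique[OF f, of f' t] e' f' l i i' by auto
    with bb show "b = b'" by simp
  qed
  moreover have "map_prod line_of line_of ` crossings \<subseteq> L \<times> L"
    using edgesD(2) unfolding crossings_def by auto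
  ultimately have "card crossings \<le> card (L \<times> L)"
    using finite_L by (intro card_inj_on_le) auto
  then show ?thesis by (simp add: card_cartesian_product power2_eq_square)
qed

text \<open>Removing the first edge of every crossing leaves a plane graph, to which
  \<open>card_edges_le\<close> applies.\<close>

lemma card_induced_edges:
  assumes "S \<subseteq> V"
  shows "card {e \<in> edges. {fst e, snd e} \<subseteq> S} \<le>
    3 * card S + card {b \<in> crossings. {fst (fst b), snd (fst b), fst (snd b), snd (snd b)} \<subseteq> S}"
proof -
  let ?E = "{e \<in> edges. {fst e, snd e} \<subseteq> S}"
  let ?B = "{b \<in> crossings. {fst (fst b), snd (fst b), fst (snd b), snd (snd b)} \<subseteq> S}"
  have "finite crossings" unfolding crossings_def using finite_edges by simp
  then have finB: "finite ?B" by simp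
  have cons: "e \<in> consecutive V (line_of e)" if "e \<in> ?E" for e
    using that edgesD by auto
  interpret plane_graph S "?E - fst ` ?B"
  proof
    show "finite S" "inj_on fst S"
      using assms finite_V inj_V by (blast intro: finite_subset inj_on_subset)+
    show "?E - fst ` ?B \<subseteq> S \<times> S" by (auto simp: mem_Times_iff)
    fix e assume e: "e \<in> ?E - fst ` ?B"
    then have ce: "e \<in> consecutive V (line_of e)" using cons by blast
    show "fst (fst e) < fst (snd e)" by (rule consecutiveD(3)[OF ce])
    show "snd v \<noteq> height e (fst v)" if "v \<in> S" "fst (fst e) < fst v" "fst v < fst (snd e)" for v
    proof
      assume "snd v = height e (fst v)"
      then have "v \<in> on_line V (line_of e)"
        using that assms consecutive_height[OF ce] by (auto simp: on_line_def)
      with consecutiveD(4)[OF ce, of v] that show False by auto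
    qed
    show "\<not> crossing_at e f t" if "f \<in> ?E - fst ` ?B" "e \<noteq> f" for f t
    proof
      assume "crossing_at e f t"
      then have "(e, f) \<in> ?B" using e that unfolding crossings_def by auto
      then have "e \<in> fst ` ?B" by force
      with e show False by blast
    qed
  qed
  have "card ?E \<le> card ((?E - fst ` ?B) \<union> fst ` ?B)"
    using finite_edges finB by (intro card_mono) auto
  also have "\<dots> \<le> card (?E - fst ` ?B) + card (fst ` ?B)" by (rule card_Un_le)
  also have "\<dots> \<le> 3 * card S + card ?B"
    by (intro add_mono card_edges_le card_image_le finB)
  finally show ?thesis .
qed

section \<open>The Szemeredi-Trotter bound\<close>

text \<open>The case \<open>m > 6 * n\<close> is what keeps the sampling probability
  \<open>p\<close> at most 1.\<close>

lemma crossing_inequality: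
  defines "n \<equiv> real (card V)" and "m \<equiv> real (card edges)"
  shows "m \<le> 6 * n \<or> m ^ 3 \<le> 72 * n ^ 2 * real (card L) ^ 2"
proof (cases "m \<le> 6 * n")
  case False
  define p where "p = 6 * n / m" \<comment> \<open>makes the vertex term half of the edge term\<close>
  define l where "l = real (card L)"
  have "n \<noteq> 0"
  proof
    assume "n = 0"
    then have "edges = {}" using edges_subset finite_V unfolding n_def by auto
    with False \<open>n = 0\<close> show False by (simp add: m_def)
  qed
  then have n: "n > 0" unfolding n_def by simp
  with False have m: "m > 0" by simp
  have p: "0 < p" "p \<le> 1" unfolding p_def using n m False by (auto simp: field_simps)
  have "m * p ^ 2 \<le> real 3 * (n * p) + card crossings * p ^ 4"
    unfolding n_def m_def
  proof (rule crossing_sampling[OF finite_V edges_subset])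
    show "crossings \<subseteq> edges \<times> edges" unfolding crossings_def by auto
    show "fst e \<noteq> snd e" if "e \<in> edges" for e
      using consecutiveD(3)[OF edgesD(1)[OF that]] by auto
  qed (use crossings_disjoint card_induced_edges p in auto)
  also have "\<dots> \<le> 3 * n * p + l ^ 2 * p ^ 4"
  proof -
    have "real (card crossings) \<le> l ^ 2"
      using of_nat_mono[OF card_crossings, where ?'a = real] unfolding l_def by simp
    then have "card crossings * p ^ 4 \<le> l ^ 2 * p ^ 4" using p by (intro mult_right_mono) auto
    then show ?thesis by simp
  qed
  finally have 1: "m * p ^ 2 \<le> 3 * n * p + l ^ 2 * p ^ 4" .
  have "m * p ^ 2 = 6 * n * p" unfolding p_def using m by (simp add: power2_eq_square)
  moreover have "l ^ 2 * p ^ 4 = p * (l ^ 2 * p ^ 3)" by (simp add: power_numeral_reduce)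
  moreover have "p * (3 * n) = 3 * n * p" by simp
  ultimately have "p * (3 * n) \<le> p * (l ^ 2 * p ^ 3)" using 1 by linarith
  then have "3 * n \<le> l ^ 2 * p ^ 3" using p by simp
  \<comment> \<open>Here \<open>216 = 6 ^ 3\<close>; cancelling \<open>n\<close> and the factor 3
    leaves 72.\<close>
  also have "\<dots> = 216 * l ^ 2 * n ^ 3 / m ^ 3" by (simp add: p_def power_divide power_mult_distrib)
  finally have "n * (3 * m ^ 3) \<le> n * (216 * l ^ 2 * n ^ 2)"
    using m by (simp add: field_simps power_numeral_reduce)
  then show ?thesis using n unfolding l_def by simp
qed simp

text \<open>As \<open>k \<ge> 2\<close>, each line carries at least \<open>k - 1 \<ge> k / 2\<close>
  edges. The two terms come from the two alternatives of \<open>crossing_inequality\<close>, with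
  \<open>576 = 8 * 72\<close>.\<close>

lemma rich_lines:
  fixes k :: real
  assumes k: "k \<ge> 2" and rich: "\<And>l. l \<in> L \<Longrightarrow> k \<le> card (on_line V l)"
  shows "real (card L) \<le> 12 * real (card V) / k + 576 * real (card V) ^ 2 / k ^ 3"
proof (cases "card L = 0")
  case False
  define n m l where "n = real (card V)" "m = real (card edges)" "l = real (card L)"
  note defs = this
  have l: "l > 0" using False defs by simp
  have "l * (k / 2) = (\<Sum>l\<in>L. k / 2)" by (simp add: defs)
  also have "\<dots> \<le> (\<Sum>l\<in>L. real (card (on_line V l) - 1))"
  proof (rule sum_mono)
    fix x assume "x \<in> L"
    then show "k / 2 \<le> real (card (on_line V x) - 1)" using rich[of x] k
      by (simp add: of_nat_diff_real)
  qed
  also have "\<dots> \<le> m" using card_edges_ge unfolding defs by (metis of_nat_le_iff of_nat_sum)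
  finally have lm: "l * k / 2 \<le> m" by simp
  have "m \<le> 6 * n \<or> m ^ 3 \<le> 72 * n ^ 2 * l ^ 2" using crossing_inequality defs by simp
  then have "l \<le> 12 * n / k \<or> l \<le> 576 * n ^ 2 / k ^ 3"
  proof
    assume "m \<le> 6 * n"
    then have "l * k \<le> 12 * n" using lm by linarith
    then show ?thesis using k by (simp add: field_simps)
  next
    assume "m ^ 3 \<le> 72 * n ^ 2 * l ^ 2"
    moreover have "(l * k / 2) ^ 3 \<le> m ^ 3" using lm l k by (intro power_mono) auto
    ultimately have "(l * k / 2) ^ 3 \<le> 72 * n ^ 2 * l ^ 2" by linarith
    then have "l ^ 2 * (l * k ^ 3) \<le> l ^ 2 * (576 * n ^ 2)"
      by (simp add: power_divide power_mult_distrib field_simps power_numeral_reduce)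
    then have "l * k ^ 3 \<le> 576 * n ^ 2" using l by simp
    then show ?thesis using k by (simp add: field_simps)
  qed
  moreover have "0 \<le> 12 * n / k" "0 \<le> 576 * n ^ 2 / k ^ 3" using k defs by auto
  ultimately show ?thesis unfolding defs by linarith
qed (use k in simp)

end

section \<open>Beck's estimate\<close>

text \<open>Two distinct points lie on at most one line, so the sets \<open>?D l\<close> are
  disjoint parts of \<open>V \<times> V\<close>.\<close>

lemma card_lines_on_pairs:
  assumes "finite V" "inj_on fst V" "finite L"
  shows "(\<Sum>l\<in>L. card (on_line V l) * (card (on_line V l) - 1)) \<le> card V ^ 2"
proof -
  let ?D = "\<lambda>l. {e \<in> on_line V l \<times> on_line V l. fst e \<noteq> snd e}"
  have fin: "finite (on_line V l)" for l
    using assms(1) on_line_subset by (rule finite_subset[rotated])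
  have cardD: "card (?D l) = card (on_line V l) * (card (on_line V l) - 1)" for l
  proof -
    have "?D l = Sigma (on_line V l) (\<lambda>u. on_line V l - {u})" by auto
    then show ?thesis using fin[of l] by (simp add: card_Diff_singleton)
  qed
  have disj: "?D l \<inter> ?D l' = {}" if "l \<noteq> l'" for l l'
  proof (rule ccontr)
    assume "?D l \<inter> ?D l' \<noteq> {}"
    then obtain e where "e \<in> ?D l" "e \<in> ?D l'" by blast
    then have e: "fst e \<noteq> snd e" "fst e \<in> on_line V l" "snd e \<in> on_line V l"
      "fst e \<in> on_line V l'" "snd e \<in> on_line V l'" by (simp_all add: mem_Times_iff)
    then have "fst (fst e) \<noteq> fst (snd e)" using assms(2) on_line_subset by (metis inj_onD subsetD)
    then have "l = l'"
      using e lines_meet_once[of l "fst (fst e)" l' "fst (snd e)"] by (simp add: on_line_def)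
    with that show False by simp
  qed
  have "(\<Sum>l\<in>L. card (on_line V l) * (card (on_line V l) - 1)) = card (\<Union>l\<in>L. ?D l)"
    using assms(3) fin disj by (subst card_UN_disjoint) (auto simp: cardD simp del: Int_iff)
  also have "\<dots> \<le> card (V \<times> V)"
    using assms(1) on_line_subset by (intro card_mono) auto
  finally show ?thesis by (simp add: card_cartesian_product power2_eq_square)
qed

text \<open>The term \<open>card L\<close> pays for lines with a single point, where
  \<open>b * (b - 1)\<close> vanishes.\<close>

lemma sum_squares_on_line:
  assumes "finite V" "inj_on fst V" "finite L"
  shows "(\<Sum>l\<in>L. real (card (on_line V l)) ^ 2) \<le> 2 * real (card V) ^ 2 + real (card L)"
proof -
  have sq: "real b ^ 2 \<le> 2 * real (b * (b - 1)) + 1" for b :: nat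
  proof (cases "b \<le> 1")
    case False
    then have "real b * 2 \<le> real b * real b" by (intro mult_left_mono) auto
    moreover have "real (b * (b - 1)) = real b * real b - real b"
      using False by (simp add: of_nat_diff_real algebra_simps)
    ultimately show ?thesis unfolding power2_eq_square by linarith
  qed (auto simp: le_Suc_eq)
  have "(\<Sum>l\<in>L. real (card (on_line V l)) ^ 2) \<le>
    (\<Sum>l\<in>L. 2 * real (card (on_line V l) * (card (on_line V l) - 1)) + 1)"
    by (intro sum_mono sq)
  also have "\<dots> = 2 * real (\<Sum>l\<in>L. card (on_line V l) * (card (on_line V l) - 1)) + card L"
    by (simp add: sum.distrib sum_distrib_left)
  also have "\<dots> \<le> 2 * real (card V ^ 2) + card L"
    using card_lines_on_pairs[OF assms] by (intro add_mono mult_left_mono of_nat_mono) auto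
  finally show ?thesis by simp
qed

lemma sum_squares_on_line_ge_2:
  assumes "finite V" "inj_on fst V" "finite L" "\<And>l. l \<in> L \<Longrightarrow> 2 \<le> card (on_line V l)"
  shows "(\<Sum>l\<in>L. real (card (on_line V l)) ^ 2) \<le> 2 * real (card V) ^ 2"
proof -
  have sq: "real b ^ 2 \<le> 2 * real (b * (b - 1))" if "2 \<le> b" for b :: nat
  proof -
    have "real b * 2 \<le> real b * real b" using that by (intro mult_left_mono) auto
    moreover have "real (b * (b - 1)) = real b * real b - real b"
      using that by (simp add: of_nat_diff_real algebra_simps)
    ultimately show ?thesis unfolding power2_eq_square by linarith
  qed
  have "(\<Sum>l\<in>L. real (card (on_line V l)) ^ 2) \<le>
    (\<Sum>l\<in>L. 2 * real (card (on_line V l) * (card (on_line V l) - 1)))"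
    by (intro sum_mono sq assms)
  also have "\<dots> = 2 * real (\<Sum>l\<in>L. card (on_line V l) * (card (on_line V l) - 1))"
    by (simp add: sum_distrib_left)
  also have "\<dots> \<le> 2 * real (card V ^ 2)"
    using card_lines_on_pairs[OF assms(1-3)] by (intro mult_left_mono of_nat_mono) auto
  finally show ?thesis by simp
qed

text \<open>Telescoping, after comparing \<open>1 / (M + 1) ^ 2\<close> with
  \<open>1 / (M * (M + 1))\<close>.\<close>

lemma sum_inverse_squares_le:
  fixes k M :: nat
  assumes "1 \<le> k" "k \<le> M"
  shows "(\<Sum>j\<in>{k<..M}. 1 / real j ^ 2) \<le> 1 / k - 1 / M"
  using assms(2)
proof (induction M rule: dec_induct)
  case (step M)
  have "{k<..Suc M} = insert (Suc M) {k<..M}" using step by auto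
  then have "(\<Sum>j\<in>{k<..Suc M}. 1 / real j ^ 2) \<le> 1 / real (Suc M) ^ 2 + (1 / k - 1 / M)"
    using step by simp
  also have "1 / real (Suc M) ^ 2 \<le> 1 / (real M * real (Suc M))"
    using assms(1) step by (intro divide_left_mono) (auto simp: power2_eq_square)
  also have "\<dots> = 1 / M - 1 / Suc M" using assms(1) step by (simp add: field_simps)
  finally show ?case by simp
qed simp

text \<open>Prepares summation by layers: after exchanging sums, \<open>2 * j - 1\<close> is
  weighted by the number of \<open>j\<close>-rich lines.\<close>

lemma square_eq_sum_odds:
  fixes k a :: nat
  assumes "k \<le> a"
  shows "real a ^ 2 = real k ^ 2 + (\<Sum>j\<in>{k<..a}. 2 * real j - 1)"
  using assms
proof (induction a rule: dec_induct)
  case (step a)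
  have "{k<..Suc a} = insert (Suc a) {k<..a}" using step by auto
  then show ?case using step by (simp add: power2_eq_square algebra_simps)
qed simp

text \<open>Summation by layers, with \<open>rich_lines\<close> at each level \<open>j\<close>. The
  terms from \<open>N / j\<close> add up over at most \<open>\<epsilon> * N\<close> levels, those
  from \<open>N ^ 2 / j ^ 3\<close> to a tail of order \<open>N ^ 2 / k\<close>.\<close>

lemma sum_squares_rich:
  fixes k :: nat and \<epsilon> :: real
  assumes V: "finite V" "inj_on fst V" and L: "finite L" and k: "2 \<le> k" and eps: "0 \<le> \<epsilon>"
    and rich: "\<And>l. l \<in> L \<Longrightarrow> k \<le> card (on_line V l)"
    and poor: "\<And>l. l \<in> L \<Longrightarrow> real (card (on_line V l)) \<le> \<epsilon> * card V"
  shows "(\<Sum>l\<in>L. real (card (on_line V l)) ^ 2) \<le> (36 * \<epsilon> + 1728 / k) * real (card V) ^ 2"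
proof (cases "L = {}")
  case True
  then show ?thesis using eps by simp
next
  case False
  define N where "N = real (card V)"
  define a where "a l = card (on_line V l)" for l
  define M where "M = nat \<lfloor>\<epsilon> * N\<rfloor>"
  have aM: "a l \<le> M" if "l \<in> L" for l
    using poor[OF that] unfolding M_def a_def N_def by (simp add: le_nat_floor)
  have MN: "real M \<le> \<epsilon> * N" unfolding M_def N_def using eps by simp
  have kM: "k \<le> M" using False rich aM unfolding a_def by (meson all_not_in_conv order_trans)
  have cnt: "real (card {l \<in> L. j \<le> a l}) \<le> 12 * N / j + 576 * N ^ 2 / real j ^ 3" if "2 \<le> j" for j :: nat
  proof -
    interpret line_arrangement V "{l \<in> L. j \<le> a l}"
      using V L by unfold_locales auto
    show ?thesis using rich_lines[of "real j"] that unfolding N_def a_def by simp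
  qed
  have "(\<Sum>l\<in>L. real (a l) ^ 2) = (\<Sum>l\<in>L. real k ^ 2 + (\<Sum>j | j \<in> {k<..M} \<and> j \<le> a l. 2 * real j - 1))"
  proof (rule sum.cong)
    fix l assume l: "l \<in> L"
    then have "{j \<in> {k<..M}. j \<le> a l} = {k<..a l}" using aM[OF l] by auto
    then show "real (a l) ^ 2 = real k ^ 2 + (\<Sum>j | j \<in> {k<..M} \<and> j \<le> a l. 2 * real j - 1)"
      using square_eq_sum_odds[of k "a l"] rich[OF l] a_def by simp
  qed simp
  also have "\<dots> = card L * real k ^ 2 + (\<Sum>j\<in>{k<..M}. \<Sum>l | l \<in> L \<and> j \<le> a l. 2 * real j - 1)"
    using L by (simp only: sum.distrib) (subst sum.swap_restrict, auto)
  also have "\<dots> = card L * real k ^ 2 + (\<Sum>j\<in>{k<..M}. card {l \<in> L. j \<le> a l} * (2 * real j - 1))"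
    by simp
  also have "\<dots> \<le> (12 * N * k + 576 * N ^ 2 / k) + (\<Sum>j\<in>{k<..M}. 24 * N + 1152 * N ^ 2 * (1 / real j ^ 2))"
  proof (intro add_mono sum_mono)
    have "{l \<in> L. k \<le> a l} = L" using rich a_def by auto
    then have "real (card L) * real k ^ 2 \<le> (12 * N / k + 576 * N ^ 2 / real k ^ 3) * real k ^ 2"
      using cnt[OF k] by (intro mult_right_mono) auto
    also have "\<dots> = 12 * N * k + 576 * N ^ 2 / k"
      using k by (simp add: field_simps power_numeral_reduce)
    finally show "real (card L) * real k ^ 2 \<le> 12 * N * k + 576 * N ^ 2 / k" .
    fix j assume "j \<in> {k<..M}"
    then have j: "2 \<le> j" using k by simp
    have "real (card {l \<in> L. j \<le> a l}) * (2 * real j - 1) \<le>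
      (12 * N / j + 576 * N ^ 2 / real j ^ 3) * (2 * real j)"
      using cnt[OF j] j N_def by (intro mult_mono) auto
    also have "\<dots> = 24 * N + 1152 * N ^ 2 * (1 / real j ^ 2)"
      using j by (simp add: field_simps power_numeral_reduce)
    finally show "real (card {l \<in> L. j \<le> a l}) * (2 * real j - 1) \<le> 24 * N + 1152 * N ^ 2 * (1 / real j ^ 2)" .
  qed
  also have "\<dots> = 12 * N * k + 576 * N ^ 2 / k + real (M - k) * (24 * N)
      + 1152 * N ^ 2 * (\<Sum>j\<in>{k<..M}. 1 / real j ^ 2)"
    by (simp add: sum.distrib sum_distrib_left)
  \<comment> \<open>\<open>k \<le> M \<le> \<epsilon> * N\<close> bounds the first and third terms;
    in the result 36 is \<open>12 + 24\<close> and 1728 is \<open>576 + 1152\<close>.\<close>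
  also have "\<dots> \<le> 12 * N * (\<epsilon> * N) + 576 * N ^ 2 / k + (\<epsilon> * N) * (24 * N) + 1152 * N ^ 2 * (1 / k)"
  proof (intro add_mono mult_left_mono mult_right_mono order_refl)
    show "(\<Sum>j\<in>{k<..M}. 1 / real j ^ 2) \<le> 1 / k"
      using sum_inverse_squares_le[of k M] k kM by (simp add: order_trans)
  qed (use MN kM N_def in auto)
  also have "\<dots> = (36 * \<epsilon> + 1728 / k) * N ^ 2"
    by (simp add: power2_eq_square algebra_simps add_divide_distrib[symmetric])
  finally show ?thesis unfolding a_def N_def .
qed

section \<open>Weighted incidence counting in the plane\<close>

text \<open>The constants are chosen such that \<open>36 * \<epsilon> + 1728 / k = 1 / 768\<close> in \<open>sum_squares_rich\<close>.\<close>

lemma planar_radial_bound: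
  fixes k :: nat and \<epsilon> :: real
  defines "k \<equiv> 2654208" and "\<epsilon> \<equiv> 1 / 55296"
  assumes fin: "finite X" "finite Y" and inj: "inj_on fst (X \<union> Y)"
    and N: "2 \<le> card Y" "card Y \<le> card X"
    and lines: "\<And>l. real (card (on_line X l)) \<le> \<epsilon> ^ 2 / 32 * card X"
  shows "\<exists>x\<in>X. card Y < 4 * k * card ((\<lambda>y. slope (x, y)) ` (Y - {x}))"
proof (rule ccontr)
  assume "\<not> ?thesis"
  then have few: "4 * k * card ((\<lambda>y. slope (x, y)) ` (Y - {x})) \<le> card Y" if "x \<in> X" for x
    using that by (auto simp: not_less)
  define a b where "a l = card (on_line Y l)" and "b l = card (on_line X l)" for l
  define n m where "n = real (card Y)" "m = real (card X)"
  note nm = this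
  have n2: "2 \<le> n" and nlm: "n \<le> m" using N nm by auto
  define L where "L = {l. k \<le> a l}"
  have injX: "inj_on fst X" and injY: "inj_on fst Y" using inj by (auto intro: inj_on_subset)
  have finY: "finite (on_line Y l)" and finX: "finite (on_line X l)" for l
    using fin on_line_subset by (meson finite_subset)+
  have finL: "finite L"
  proof (rule finite_subset)
    show "L \<subseteq> line_of ` (Y \<times> Y)"
    proof
      fix l assume "l \<in> L"
      then have "2 \<le> card (on_line Y l)" by (simp add: L_def a_def k_def)
      then have "1 \<le> card (consecutive Y l)" using card_consecutive[OF fin(2) injY, of l] by simp
      then have "consecutive Y l \<noteq> {}" by auto
      then obtain e where e: "e \<in> consecutive Y l" by blast
      then have "line_of e = l" by (rule consecutive_line_of)
      moreover have "e \<in> Y \<times> Y"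
        using e on_line_subset[of Y l] by (auto simp: consecutive_def mem_Times_iff)
      ultimately show "l \<in> line_of ` (Y \<times> Y)" by blast
    qed
  qed (use fin in simp)
  \<comment> \<open>The lines through \<open>x\<close> outside \<open>L\<close> cover at most
    \<open>n / 4\<close> points: at most \<open>n / (4 * k)\<close> directions with fewer than
    \<open>k\<close> points each. The point \<open>x\<close> itself costs
    \<open>1 \<le> n / 2\<close>, so rich lines keep at least \<open>n / 4\<close>.\<close>
  have incidences: "n / 4 \<le> (\<Sum>l | l \<in> L \<and> x \<in> on_line X l. real (a l))" if x: "x \<in> X" for x
  proof -
    define S where "S = (\<lambda>y. slope (x, y)) ` (Y - {x})"
    define ray where "ray s = (s, snd x - s * fst x)" for s
    have finS: "finite S" using fin S_def by simp
    have x_ray: "x \<in> on_line X (ray s)" for s using x by (simp add: on_line_def ray_def)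
    have y_ray: "y \<in> on_line Y (ray (slope (x, y)))" if y: "y \<in> Y - {x}" for y
    proof -
      have "fst y \<noteq> fst x" using inj x y by (auto dest: inj_onD)
      then have "slope (x, y) * (fst y - fst x) = snd y - snd x" by (simp add: slope_def)
      then show ?thesis using y by (simp add: on_line_def ray_def algebra_simps)
    qed
    let ?A = "\<Union>s\<in>{s \<in> S. ray s \<notin> L}. on_line Y (ray s)"
    let ?B = "\<Union>l\<in>{l \<in> L. x \<in> on_line X l}. on_line Y l"
    have "Y \<subseteq> {x} \<union> (?A \<union> ?B)"
    proof
      fix y assume y: "y \<in> Y"
      show "y \<in> {x} \<union> (?A \<union> ?B)"
      proof (cases "y = x")
        case False
        then have "slope (x, y) \<in> S" "y \<in> on_line Y (ray (slope (x, y)))"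
          using y y_ray S_def by auto
        then show ?thesis using x_ray[of "slope (x, y)"] by blast
      qed simp
    qed
    then have "card Y \<le> card ({x} \<union> (?A \<union> ?B))"
      using finS finL finY by (intro card_mono) auto
    also have "\<dots> \<le> card {x} + card (?A \<union> ?B)" by (rule card_Un_le)
    also have "\<dots> \<le> 1 + (card ?A + card ?B)" using card_Un_le[of ?A ?B] by simp
    finally have 1: "card Y \<le> 1 + (card ?A + card ?B)" .
    have "card ?A \<le> (\<Sum>s\<in>{s \<in> S. ray s \<notin> L}. card (on_line Y (ray s)))"
      using finS by (intro card_UN_le) auto
    also have "\<dots> \<le> (\<Sum>s\<in>{s \<in> S. ray s \<notin> L}. k)"
      by (intro sum_mono) (auto simp: L_def a_def)
    also have "\<dots> \<le> card S * k" using finS by (simp add: card_mono)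
    finally have 2: "card ?A \<le> card S * k" .
    have "4 * k * card S \<le> card Y" using few[OF x] S_def by simp
    with 2 have 2: "4 * card ?A \<le> card Y" by (simp add: algebra_simps)
    have "card ?B \<le> (\<Sum>l | l \<in> L \<and> x \<in> on_line X l. a l)"
      unfolding a_def using finL by (intro card_UN_le) auto
    with 1 2 N have "card Y \<le> 4 * (\<Sum>l | l \<in> L \<and> x \<in> on_line X l. a l)" by linarith
    then have "real (card Y) \<le> real (4 * (\<Sum>l | l \<in> L \<and> x \<in> on_line X l. a l))"
      by (rule of_nat_mono)
    then show ?thesis by (simp add: nm)
  qed
  \<comment> \<open>Double counting of the incidences between \<open>X\<close> and rich lines,
    weighted by \<open>a\<close>.\<close>
  have "m * n / 4 = (\<Sum>x\<in>X. n / 4)" by (simp add: nm)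
  also have "\<dots> \<le> (\<Sum>x\<in>X. \<Sum>l | l \<in> L \<and> x \<in> on_line X l. real (a l))"
    by (intro sum_mono incidences)
  also have "\<dots> = (\<Sum>l\<in>L. \<Sum>x | x \<in> X \<and> x \<in> on_line X l. real (a l))"
    by (rule sum.swap_restrict[OF fin(1) finL])
  also have "\<dots> = (\<Sum>l\<in>L. real (b l) * real (a l))"
    using on_line_subset[of X] by (intro sum.cong) (auto simp: b_def intro!: arg_cong[of _ _ card])
  finally have lower: "m * n / 4 \<le> (\<Sum>l\<in>L. real (b l) * real (a l))" .
  define L1 L2 where "L1 = {l \<in> L. real (a l) \<le> \<epsilon> * n}" and "L2 = {l \<in> L. \<not> real (a l) \<le> \<epsilon> * n}"
  have fin12: "finite L1" "finite L2" using finL by (auto simp: L1_def L2_def)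
  have "L = L1 \<union> L2" "L1 \<inter> L2 = {}" by (auto simp: L1_def L2_def)
  then have split: "(\<Sum>l\<in>L. real (b l) * real (a l)) =
      (\<Sum>l\<in>L1. real (b l) * real (a l)) + (\<Sum>l\<in>L2. real (b l) * real (a l))"
    using fin12 by (simp add: sum.union_disjoint)
  \<comment> \<open>At most \<open>2 / \<epsilon> ^ 2\<close> lines are this rich, which cancels the
    factor \<open>\<epsilon> ^ 2\<close> in \<open>lines\<close>.\<close>
  have "card L2 * (\<epsilon> * n) ^ 2 = (\<Sum>l\<in>L2. (\<epsilon> * n) ^ 2)" by simp
  also have "\<dots> \<le> (\<Sum>l\<in>L2. real (a l) ^ 2)"
    using n2 by (intro sum_mono power_mono) (auto simp: L2_def \<epsilon>_def)
  also have "\<dots> \<le> 2 * n ^ 2"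
    unfolding a_def nm
    by (rule sum_squares_on_line_ge_2[OF fin(2) injY fin12(2)]) (auto simp: L2_def L_def a_def k_def)
  finally have "card L2 * \<epsilon> ^ 2 * n ^ 2 \<le> 2 * n ^ 2" by (simp add: power_mult_distrib)
  then have L2: "card L2 * \<epsilon> ^ 2 \<le> 2" using n2 by simp
  have "(\<Sum>l\<in>L2. real (b l) * real (a l)) \<le> (\<Sum>l\<in>L2. (\<epsilon> ^ 2 / 32 * m) * n)"
    using lines card_mono[OF fin(2) on_line_subset] unfolding a_def b_def nm
    by (intro sum_mono mult_mono) auto
  also have "\<dots> = (card L2 * \<epsilon> ^ 2) * (m * n / 32)" by simp
  also have "\<dots> \<le> 2 * (m * n / 32)" by (intro mult_right_mono L2) (auto simp: nm)
  finally have up2: "(\<Sum>l\<in>L2. real (b l) * real (a l)) \<le> m * n / 16" by simp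
  have "(\<Sum>l\<in>L1. real (a l) ^ 2) \<le> (36 * \<epsilon> + 1728 / k) * n ^ 2"
    unfolding a_def nm
    by (rule sum_squares_rich[OF fin(2) injY fin12(1)])
      (auto simp: L1_def L_def a_def k_def \<epsilon>_def nm)
  then have a1: "(\<Sum>l\<in>L1. real (a l) ^ 2) \<le> n ^ 2 / 768" by (simp add: k_def \<epsilon>_def)
  \<comment> \<open>Lines of \<open>L1\<close> may hold a single point of \<open>X\<close>, so
    \<open>sum_squares_on_line\<close> leaves the term \<open>card L1\<close>;
    \<open>n \<le> m\<close> keeps it below \<open>m ^ 2\<close>.\<close>
  have "real (card L1) = (\<Sum>l\<in>L1. 1)" by simp
  also have "\<dots> \<le> (\<Sum>l\<in>L1. real (a l) ^ 2)"
    by (intro sum_mono) (auto simp: L1_def L_def k_def)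
  also have "\<dots> \<le> n ^ 2" using a1 zero_le_power2[of n] by linarith
  also have "\<dots> \<le> m ^ 2" using nlm n2 by (intro power_mono) auto
  finally have "(\<Sum>l\<in>L1. real (b l) ^ 2) \<le> 3 * m ^ 2"
    using sum_squares_on_line[OF fin(1) injX fin12(1)] unfolding b_def nm by linarith
  then have "(\<Sum>l\<in>L1. real (b l) ^ 2) * (\<Sum>l\<in>L1. real (a l) ^ 2) \<le> (3 * m ^ 2) * (n ^ 2 / 768)"
    by (intro mult_mono a1 sum_nonneg) auto
  with Cauchy_Schwarz_ineq_sum[of "\<lambda>l. real (b l)" "\<lambda>l. real (a l)" L1]
  have "(\<Sum>l\<in>L1. real (b l) * real (a l)) ^ 2 \<le> (3 * m ^ 2) * (n ^ 2 / 768)" by linarith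
  \<comment> \<open>Here \<open>3 / 768 = 1 / 16 ^ 2\<close>; two shares of \<open>1 / 16\<close>
    stay below the required \<open>1 / 4\<close>.\<close>
  also have "\<dots> = (m * n / 16) ^ 2" by (simp add: power_divide power_mult_distrib)
  finally have up1: "(\<Sum>l\<in>L1. real (b l) * real (a l)) \<le> m * n / 16"
    by (rule power2_le_imp_le) (auto simp: nm)
  have "m * n / 4 \<le> m * n / 16 + m * n / 16" using lower split up1 up2 by linarith
  moreover have "m * n > 0" using n2 nlm by simp
  ultimately show False by linarith
qed

section \<open>Reduction to the plane\<close>

text \<open>Each nonzero vector excludes only a hyperplane, and finitely many null sets do not cover
  the space.\<close>

lemma generic_functional:
  fixes W :: "'a::euclidean_space set"
  assumes "finite W" "0 \<notin> W"
  obtains u where "\<And>w. w \<in> W \<Longrightarrow> u \<bullet> w \<noteq> 0"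
proof -
  have "negligible {u. w \<bullet> u = 0}" if "w \<in> W" for w
    using negligible_hyperplane[of w 0] assms(2) that by auto
  then have "negligible (\<Union>w\<in>W. {u. w \<bullet> u = 0})"
    using assms(1) by (intro negligible_Union) auto
  then have "(\<Union>w\<in>W. {u. w \<bullet> u = 0}) \<noteq> UNIV" using non_negligible_UNIV by metis
  then obtain u where "u \<notin> (\<Union>w\<in>W. {u. w \<bullet> u = 0})" by blast
  then show thesis by (intro that[of u]) (auto simp: inner_commute)
qed

text \<open>Two generic functionals suffice: the first separates points, and then every non-collinear
  triple yields a nonzero vector that the second must not annihilate.\<close>

lemma generic_projection:
  fixes Z :: "'a::euclidean_space set"
  assumes "finite Z"
  obtains u v where "inj_on ((\<bullet>) u) Z"
    "\<And>x y z. x \<in> Z \<Longrightarrow> y \<in> Z \<Longrightarrow> z \<in> Z \<Longrightarrow> x \<noteq> y \<Longrightarrow>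
      (u \<bullet> (y - x)) * (v \<bullet> (z - x)) = (u \<bullet> (z - x)) * (v \<bullet> (y - x)) \<Longrightarrow> z \<in> affine hull {x, y}"
proof -
  have "finite ((\<lambda>(x, y). y - x) ` (Z \<times> Z) - {0})" using assms by auto
  then obtain u where "\<And>w. w \<in> (\<lambda>(x, y). y - x) ` (Z \<times> Z) - {0} \<Longrightarrow> u \<bullet> w \<noteq> 0"
    by (rule generic_functional) auto
  then have u: "u \<bullet> (y - x) \<noteq> 0" if "x \<in> Z" "y \<in> Z" "x \<noteq> y" for x y using that by force
  \<comment> \<open>\<open>v \<bullet> ?h (x, y, z)\<close> is the determinant testing the projected
    triple for collinearity, while \<open>?h (x, y, z) = 0\<close> puts \<open>z\<close> on the line
    through \<open>x\<close> and \<open>y\<close>, as \<open>u\<close> separates these two.\<close>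
  let ?h = "\<lambda>(x, y, z). (u \<bullet> (y - x)) *\<^sub>R (z - x) - (u \<bullet> (z - x)) *\<^sub>R (y - x)"
  have "finite (?h ` (Z \<times> Z \<times> Z) - {0})" using assms by auto
  then obtain v where v: "\<And>w. w \<in> ?h ` (Z \<times> Z \<times> Z) - {0} \<Longrightarrow> v \<bullet> w \<noteq> 0"
    by (rule generic_functional) auto
  show thesis
  proof
    show "inj_on ((\<bullet>) u) Z"
      using u by (intro inj_onI) (metis eq_iff_diff_eq_0 inner_diff_right)
    fix x y z assume *: "x \<in> Z" "y \<in> Z" "z \<in> Z" "x \<noteq> y"
      "(u \<bullet> (y - x)) * (v \<bullet> (z - x)) = (u \<bullet> (z - x)) * (v \<bullet> (y - x))"
    have mem: "?h (x, y, z) \<in> ?h ` (Z \<times> Z \<times> Z)" by (rule imageI) (use * in auto)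
    have "v \<bullet> ?h (x, y, z) = 0" using *(5) by (simp add: inner_diff_right)
    with v[of "?h (x, y, z)"] mem have "?h (x, y, z) = 0" by blast
    then have eq: "(u \<bullet> (y - x)) *\<^sub>R (z - x) = (u \<bullet> (z - x)) *\<^sub>R (y - x)" by simp
    define t where "t = (u \<bullet> (z - x)) / (u \<bullet> (y - x))"
    have "z - x = t *\<^sub>R (y - x)"
      using arg_cong[OF eq, of "\<lambda>w. w /\<^sub>R (u \<bullet> (y - x))"] u[OF *(1,2,4)]
      by (simp add: t_def divide_inverse mult.commute)
    then have "z = (1 - t) *\<^sub>R x + t *\<^sub>R y" by (simp add: algebra_simps)
    moreover have "(1 - t) + t = 1" by simp
    ultimately show "z \<in> affine hull {x, y}" unfolding affine_hull_2 by blast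
  qed
qed

lemma affine_line_hull:
  fixes x y :: "real ^ 'n::finite"
  shows "x \<noteq> y \<Longrightarrow> affine_line (affine hull {x, y})"
  by (simp add: affine_line_def)

lemma card_inter_affine_line:
  fixes X :: "(real ^ 'n::finite) set"
  assumes "finite X" "affine_line L"
    and "\<And>L. affine_line L \<Longrightarrow> c * real (card X) \<le> real (card (X - L))"
    and "P \<subseteq> X \<inter> L"
  shows "real (card P) \<le> (1 - c) * real (card X)"
proof -
  have "card P \<le> card (X \<inter> L)" using assms(1,4) by (intro card_mono) auto
  moreover have "card X = card (X \<inter> L) + card (X - L)" using assms(1) by (rule card_Int_Diff)
  ultimately have "real (card P) + real (card (X - L)) \<le> real (card X)" by linarith
  then show ?thesis using assms(3)[OF assms(2)] by (simp add: algebra_simps)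
qed

theorem corollary4p5:
  assumes "CARD('n::finite) \<ge> 2"
  shows "\<exists>c K :: real. 0 < c \<and> c < 1 \<and> K > 0 \<and>
    (\<forall>X :: (real ^ 'n) set. finite X \<longrightarrow> X \<noteq> {} \<longrightarrow>
       (\<forall>L. affine_line L \<longrightarrow> real (card (X - L)) \<ge> c * real (card X)) \<longrightarrow>
       (\<forall>Y :: (real ^ 'n) set. finite Y \<longrightarrow>
          real (MAX x\<in>X. card (radial_proj x ` (Y - {x}))) \<ge> K * real (min (card X) (card Y))))"
proof -
  \<comment> \<open>The constants of \<open>planar_radial_bound\<close>; \<open>c\<close> leaves
    each line at most the share \<open>\<epsilon> ^ 2 / 32\<close> of \<open>X\<close> allowed
    there.\<close>
  define \<epsilon> :: real where "\<epsilon> = 1 / 55296"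
  define k :: nat where "k = 2654208"
  define K :: real where "K = 1 / (4 * k)"
  define c where "c = 1 - \<epsilon> ^ 2 / 32"
  have c: "0 < c" "c < 1" unfolding c_def \<epsilon>_def by (auto simp: power2_eq_square)
  have main: "\<exists>x\<in>X. real (min (card X) (card Y)) \<le> 4 * k * real (card (radial_proj x ` (Y - {x})))"
    if X: "finite X" "X \<noteq> {}" and Y: "finite Y"
      and lines: "\<And>L. affine_line L \<Longrightarrow> c * real (card X) \<le> real (card (X - L))"
    for X Y :: "(real ^ 'n) set"
  proof -
    have small: "real (card P) \<le> \<epsilon> ^ 2 / 32 * card X" if "affine_line L" "P \<subseteq> X \<inter> L" for P L
      using card_inter_affine_line[OF X(1) that(1) lines that(2)] by (simp add: c_def)
    \<comment> \<open>A point lies on some line, here in an arbitrary coordinate direction, so the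
      bound for lines covers it.\<close>
    have single: "real (card P) \<le> \<epsilon> ^ 2 / 32 * card X" if P: "P \<subseteq> X" "P \<subseteq> {x}" for P x
    proof (rule small)
      show "affine_line (affine hull {x, x + axis undefined 1})"
        by (rule affine_line_hull) (simp add: axis_eq_0_iff)
      show "P \<subseteq> X \<inter> affine hull {x, x + axis undefined 1}"
        using P hull_subset[of "{x, x + axis undefined 1}" affine] by blast
    qed
    consider "min (card X) (card Y) = 0" | "min (card X) (card Y) = 1" | "2 \<le> min (card X) (card Y)"
      by linarith
    then show ?thesis
    proof cases
      case 1
      then show ?thesis using X(2) by auto
    next
      case 2
      then obtain y where y: "y \<in> Y" by fastforce
      \<comment> \<open>The planar bound asks for two points of \<open>Y\<close>; here one direction
        suffices, seen from any \<open>x \<noteq> y\<close>. Such an \<open>x\<close> exists since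
        \<open>c > 0\<close> keeps \<open>X\<close> from lying on one line.\<close>
      have "\<exists>x\<in>X. x \<noteq> y"
      proof (rule ccontr)
        assume "\<not> ?thesis"
        then have "real (card X) \<le> \<epsilon> ^ 2 / 32 * card X" using single[of X y] by blast
        moreover have "card X > 0" using X by (simp add: card_gt_0_iff)
        ultimately show False using c by (simp add: c_def)
      qed
      then obtain x where x: "x \<in> X" "x \<noteq> y" by blast
      then have "card (radial_proj x ` (Y - {x})) > 0" using y Y by (auto simp: card_gt_0_iff)
      then have "1 \<le> 4 * k * real (card (radial_proj x ` (Y - {x})))" by (simp add: k_def)
      then show ?thesis using 2 x by auto
    next
      case 3
      \<comment> \<open>The planar bound wants at most \<open>card X\<close> points, and a subset of
        \<open>Y\<close> shows no more directions than \<open>Y\<close>.\<close>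
      obtain Y' where Y': "Y' \<subseteq> Y" "card Y' = min (card X) (card Y)"
        by (meson min.cobounded2 obtain_subset_with_card_n)
      have finY': "finite Y'" using Y' Y finite_subset by blast
      obtain u v where inj: "inj_on ((\<bullet>) u) (X \<union> Y')"
        and coll: "\<And>x y z. x \<in> X \<union> Y' \<Longrightarrow> y \<in> X \<union> Y' \<Longrightarrow> z \<in> X \<union> Y' \<Longrightarrow> x \<noteq> y \<Longrightarrow>
          (u \<bullet> (y - x)) * (v \<bullet> (z - x)) = (u \<bullet> (z - x)) * (v \<bullet> (y - x)) \<Longrightarrow> z \<in> affine hull {x, y}"
        using generic_projection[of "X \<union> Y'"] X(1) finY' by auto
      define \<phi> where "\<phi> z = (u \<bullet> z, v \<bullet> z)" for z
      have inj_\<phi>: "inj_on \<phi> (X \<union> Y')" using inj unfolding \<phi>_def inj_on_def by auto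
      have cardX: "card (\<phi> ` X) = card X" and cardY: "card (\<phi> ` Y') = card Y'"
        using inj_\<phi> by (auto intro!: card_image intro: inj_on_subset)
      have "\<exists>x\<in>\<phi> ` X. card (\<phi> ` Y') < 4 * 2654208 * card ((\<lambda>y. slope (x, y)) ` (\<phi> ` Y' - {x}))"
      proof (rule planar_radial_bound)
        have "fst \<circ> \<phi> = (\<bullet>) u" by (simp add: \<phi>_def comp_def)
        then have "inj_on fst (\<phi> ` (X \<union> Y'))" using inj by (intro inj_on_imageI) simp
        then show "inj_on fst (\<phi> ` X \<union> \<phi> ` Y')" by (simp add: image_Un)
        show "2 \<le> card (\<phi> ` Y')" "card (\<phi> ` Y') \<le> card (\<phi> ` X)"
          using 3 Y' cardX cardY by auto
        fix l
        define P where "P = {x \<in> X. \<phi> x \<in> on_line (\<phi> ` X) l}"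
        have "on_line (\<phi> ` X) l = \<phi> ` P" unfolding P_def on_line_def by auto
        moreover have "finite P" using X(1) by (simp add: P_def)
        ultimately have "card (on_line (\<phi> ` X) l) \<le> card P" by (metis card_image_le)
        moreover have "real (card P) \<le> \<epsilon> ^ 2 / 32 * card X"
        \<comment> \<open>Two points of \<open>P\<close> span an affine line containing
          \<open>P\<close>, because \<open>coll\<close> lifts planar collinearity; otherwise
          \<open>P\<close> has at most one point.\<close>
        proof (cases "\<exists>x\<in>P. \<exists>y\<in>P. x \<noteq> y")
          case True
          then obtain x y where xy: "x \<in> P" "y \<in> P" "x \<noteq> y" by blast
          have "z \<in> affine hull {x, y}" if z: "z \<in> P" for z
          proof (rule coll)
            have "v \<bullet> (p - x) = fst l * (u \<bullet> (p - x))" if "p \<in> P" for p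
              using that xy(1) by (simp add: P_def on_line_def \<phi>_def inner_diff_right algebra_simps)
            then show "(u \<bullet> (y - x)) * (v \<bullet> (z - x)) = (u \<bullet> (z - x)) * (v \<bullet> (y - x))"
              using xy z by simp
          qed (use xy z P_def in auto)
          then show ?thesis
            by (intro small[OF affine_line_hull[OF xy(3)]]) (auto simp: P_def)
        next
          case False
          then obtain x where "P \<subseteq> {x}" by blast
          then show ?thesis by (rule single[rotated]) (auto simp: P_def)
        qed
        ultimately show "real (card (on_line (\<phi> ` X) l)) \<le> (1 / 55296) ^ 2 / 32 * card (\<phi> ` X)"
          unfolding cardX \<epsilon>_def by linarith
      qed (use X finY' in auto)
      then obtain x where x: "x \<in> X"
        and gt: "card Y' < 4 * k * card ((\<lambda>y. slope (\<phi> x, y)) ` (\<phi> ` Y' - {\<phi> x}))"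
        unfolding cardY k_def by blast
      \<comment> \<open>The planar slope is a function of the direction from \<open>x\<close> to
        \<open>y\<close>: the nonzero norm cancels in the quotient. So there are at most as many
        slopes as directions.\<close>
      have "(\<lambda>y. slope (\<phi> x, y)) ` (\<phi> ` Y' - {\<phi> x}) \<subseteq>
        (\<lambda>r. (v \<bullet> r) / (u \<bullet> r)) ` radial_proj x ` (Y - {x})"
      proof
        fix s assume "s \<in> (\<lambda>y. slope (\<phi> x, y)) ` (\<phi> ` Y' - {\<phi> x})"
        then obtain y where y: "y \<in> Y'" "y \<noteq> x" "s = slope (\<phi> x, \<phi> y)" by blast
        then have "s = (v \<bullet> radial_proj x y) / (u \<bullet> radial_proj x y)"
          by (simp add: slope_def \<phi>_def radial_proj_def inner_diff_right)
        then show "s \<in> (\<lambda>r. (v \<bullet> r) / (u \<bullet> r)) ` radial_proj x ` (Y - {x})"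
          using y Y'(1) by blast
      qed
      then have "card ((\<lambda>y. slope (\<phi> x, y)) ` (\<phi> ` Y' - {\<phi> x})) \<le> card (radial_proj x ` (Y - {x}))"
        using Y by (intro surj_card_le) auto
      then have "4 * k * card ((\<lambda>y. slope (\<phi> x, y)) ` (\<phi> ` Y' - {\<phi> x})) \<le>
        4 * k * card (radial_proj x ` (Y - {x}))" by (rule mult_left_mono) simp
      with gt Y'(2) have "min (card X) (card Y) \<le> 4 * k * card (radial_proj x ` (Y - {x}))" by linarith
      then have "real (min (card X) (card Y)) \<le> real (4 * k * card (radial_proj x ` (Y - {x})))"
        by (rule of_nat_mono)
      then show ?thesis using x by (intro bexI[of _ x]) auto
    qed
  qed
  show ?thesis
  proof (rule exI[of _ c], rule exI[of _ K], intro conjI allI impI)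
    fix X Y :: "(real ^ 'n) set"
    assume X: "finite X" "X \<noteq> {}" and "finite Y"
      and "\<forall>L. affine_line L \<longrightarrow> real (card (X - L)) \<ge> c * real (card X)"
    then obtain x where x: "x \<in> X"
      "real (min (card X) (card Y)) \<le> 4 * k * real (card (radial_proj x ` (Y - {x})))"
      using main by blast
    have "K * real (min (card X) (card Y)) \<le> real (card (radial_proj x ` (Y - {x})))"
      using x(2) by (simp add: K_def k_def)
    also have "\<dots> \<le> real (MAX x\<in>X. card (radial_proj x ` (Y - {x})))"
      using X x(1) by (intro of_nat_mono Max_ge) auto
    finally show "K * real (min (card X) (card Y)) \<le>
      real (MAX x\<in>X. card (radial_proj x ` (Y - {x})))" .
  qed (use c in \<open>auto simp: K_def k_def\<close>)
qed

end
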